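(* Let $F$ be a field with $\operatorname{Char}(F)\neq 2$ and let $R$ be a simple associative unital $F$-algebra. Let $*$ be an involution on $R$ of the first kind with set of symmetric elements $S$, and assume $S\subsetneq R$. Assume $S$ is not a commutative set. Then $S^3=R$.
   Context: $S=\{r\in R: r^*=r\}$. The involution $*$ is of the first kind if $Z(R)\subseteq S$, where $Z(R)$ is the center of $R$. A subset $A\subseteq R$ is a commutative set if $xy=yx$ for all $x,y\in A$. For subsets $A,B\subseteq R$, $AB$ denotes the $F$-subspace of $R$ generated by all products $ab$ with $a\in A$, $b\in B$; $S^3=SSS$ is the $F$-subspace generated by all $abc$ with $a,b,c\in S$. *)

theory Defs
  imports Complex_Main
begin

text \<open>
  Rings are types of class \<^class>\<open>ring_1\<close>, so they are associative, unital and nonzero.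
\<close>

locale unital_algebra = vector_space scale
  for scale :: "'f::field \<Rightarrow> 'r::ring_1 \<Rightarrow> 'r" (infixr \<open>*s\<close> 75) +
  assumes scale_mult_left: "(a *s x) * y = a *s (x * y)"
    and scale_mult_right: "x * (a *s y) = a *s (x * y)"

definition two_sided_ideal :: "'r::ring_1 set \<Rightarrow> bool" where
  "two_sided_ideal I \<longleftrightarrow>
     0 \<in> I \<and> (\<forall>x\<in>I. \<forall>y\<in>I. x + y \<in> I) \<and> (\<forall>x\<in>I. - x \<in> I) \<and>
     (\<forall>x\<in>I. \<forall>r. r * x \<in> I \<and> x * r \<in> I)"

text \<open>
  In a unital algebra every two-sided ideal of the ring is a subspace, so the algebra is simple
  exactly when the underlying ring is. The condition \<open>0 \<noteq> R\<close> is part of \<^class>\<open>ring_1\<close>.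
\<close>

definition simple_ring :: "'r::ring_1 itself \<Rightarrow> bool" where
  "simple_ring _ \<longleftrightarrow> (\<forall>I :: 'r set. two_sided_ideal I \<longrightarrow> I = {0} \<or> I = UNIV)"

definition ring_center :: "'r::ring_1 set" where
  "ring_center = {z. \<forall>x. z * x = x * z}"

text \<open>
  No linearity over the base field is required here; for involutions of the first kind, linearity
  over any field acting centrally is automatic.
\<close>

definition ring_involution :: "('r::ring_1 \<Rightarrow> 'r) \<Rightarrow> bool" where
  "ring_involution star \<longleftrightarrow>
     (\<forall>x y. star (x + y) = star x + star y) \<and>
     (\<forall>x y. star (x * y) = star y * star x) \<and>
     (\<forall>x. star (star x) = x)"

definition symmetric_elements :: "('r \<Rightarrow> 'r) \<Rightarrow> 'r set" where
  "symmetric_elements star = {r. star r = r}"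

definition first_kind :: "('r::ring_1 \<Rightarrow> 'r) \<Rightarrow> bool" where
  "first_kind star \<longleftrightarrow> ring_center \<subseteq> symmetric_elements star"

definition commutative_set :: "'r::ring_1 set \<Rightarrow> bool" where
  "commutative_set A \<longleftrightarrow> (\<forall>x\<in>A. \<forall>y\<in>A. x * y = y * x)"

definition (in unital_algebra) triple_product :: "'r set \<Rightarrow> 'r set \<Rightarrow> 'r set \<Rightarrow> 'r set" where
  "triple_product A B C = span {a * b * c |a b c. a \<in> A \<and> b \<in> B \<and> c \<in> C}"

end

theory Submission
  imports Defs
begin

text \<open>
  Write \<open>K\<close> for the skew elements, so that \<open>R = S + K\<close>, and let \<open>C = [S, S]\<close> be the span of the
  commutators of symmetric elements. Splitting a product into its Jordan and its Lie part,
  \<open>2xy = (xy + yx) + (xy - yx)\<close>, and using that \<open>C \<subseteq> K\<close> is normalised by \<open>K\<close>, one gets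
  \<open>CK, KC \<subseteq> S + C \<subseteq> S\<^sup>2\<close>, whereas \<open>CS \<subseteq> S\<^sup>3\<close> is clear. Hence \<open>CR \<subseteq> S\<^sup>3\<close>
  (\<open>comm_span_mult_in_cube\<close>).

  To multiply on the left as well, move the left factor past \<open>C\<close>: \<open>xc = [x, c] + cx\<close>. The term
  \<open>cx\<close> stays harmless under any further right multiplication, and \<open>[x, c]\<close> lies in \<open>C\<close> for skew
  \<open>x\<close> and in \<open>S\<close> for symmetric \<open>x\<close>. This gives \<open>RCR \<subseteq> S\<^sup>3\<close> (\<open>mult_comm_span_mult_in_cube\<close>).
  If \<open>S\<close> is not commutative then \<open>C \<noteq> 0\<close>, so simplicity forces \<open>RCR = R\<close>, and \<open>S\<^sup>3 = R\<close>.
\<close>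

locale first_kind_algebra = unital_algebra scale
  for scale :: "'f::field \<Rightarrow> 'r::ring_1 \<Rightarrow> 'r" (infixr \<open>*s\<close> 75) +
  fixes star :: "'r \<Rightarrow> 'r"
  assumes two_nonzero: "(2::'f) \<noteq> 0"
    and involution: "ring_involution star"
    and first_kind: "first_kind star"
begin

abbreviation S :: "'r set" where
  "S \<equiv> symmetric_elements star"

definition K :: "'r set" where
  "K = {k. star k = - k}"

definition comm_span :: "'r set" where
  "comm_span = span {a * b - b * a |a b. a \<in> S \<and> b \<in> S}"

definition square :: "'r set" where
  "square = span {a * b |a b. a \<in> S \<and> b \<in> S}"

abbreviation cube :: "'r set" where
  "cube \<equiv> triple_product S S S"

section \<open>Symmetric and skew elements\<close>

lemma star_add: "star (x + y) = star x + star y"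
  and star_mult: "star (x * y) = star y * star x"
  and star_star: "star (star x) = x"
  using involution by (auto simp: ring_involution_def)

lemma star_zero: "star 0 = 0"
  using star_add[of 0 0] by simp

lemma star_minus: "star (- x) = - star x"
  using star_add[of x "- x"] star_zero minus_unique[of "star x" "star (- x)"] by simp

lemma star_diff: "star (x - y) = star x - star y"
  using star_add[of x "- y"] by (simp add: star_minus)

lemma star_one: "star 1 = 1"
  using star_mult[of "star 1" 1] by (simp add: star_star)

text \<open>Scalar multiples of \<open>1\<close> are central, hence symmetric for an involution of the first kind.\<close>
lemma star_scale: "star (a *s x) = a *s star x"
proof -
  have "a *s 1 \<in> (ring_center :: 'r set)"
    by (simp add: ring_center_def scale_mult_left scale_mult_right)
  then have "star (a *s 1) = a *s 1"
    using first_kind by (auto simp: first_kind_def symmetric_elements_def)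
  then show ?thesis
    using star_mult[of "a *s 1" x] by (simp add: scale_mult_left scale_mult_right)
qed

lemma mem_S: "x \<in> S \<longleftrightarrow> star x = x"
  by (simp add: symmetric_elements_def)

lemma mem_K: "x \<in> K \<longleftrightarrow> star x = - x"
  by (simp add: K_def)

lemma one_in_S: "1 \<in> S"
  by (simp add: mem_S star_one)

lemma subspace_S: "subspace S"
  by (simp add: subspace_def mem_S star_zero star_add star_scale)

lemma subspace_K: "subspace K"
  by (simp add: subspace_def mem_K star_zero star_add star_scale)

lemma subspace_halve:
  assumes "subspace V" "x + x \<in> V"
  shows "x \<in> V"
proof -
  have "x + x = (2::'f) *s x"
    using scale_left_distrib[of 1 1 x] by simp
  then have "(1/2) *s (x + x) = x"
    using two_nonzero by simp
  then show ?thesis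
    using subspace_scale[OF assms, of "1/2"] by simp
qed

lemma symmetric_skew_cases:
  assumes V: "subspace V"
    and add: "\<And>x y. f (x + y) = f x + f y"
    and S: "\<And>x. x \<in> S \<Longrightarrow> f x \<in> V"
    and K: "\<And>x. x \<in> K \<Longrightarrow> f x \<in> V"
  shows "f x \<in> V"
proof -
  have "x + star x \<in> S" "x - star x \<in> K"
    by (simp_all add: mem_S mem_K star_add star_diff star_star add.commute)
  then have "f (x + star x) + f (x - star x) \<in> V"
    by (rule subspace_add[OF V S K])
  moreover have "f (x + star x) + f (x - star x) = f x + f x"
    using add[of "x + star x" "x - star x"] add[of x x] by simp
  ultimately have "f x + f x \<in> V" by simp
  then show ?thesis by (rule subspace_halve[OF V])
qed

section \<open>Commutators of symmetric elements\<close>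

lemma subspace_comm_span: "subspace comm_span"
  by (simp add: comm_span_def)

lemma subspace_square: "subspace square"
  by (simp add: square_def)

lemma subspace_cube: "subspace cube"
  by (simp add: triple_product_def)

lemma commutator_in_comm_span: "a \<in> S \<Longrightarrow> b \<in> S \<Longrightarrow> a * b - b * a \<in> comm_span"
  unfolding comm_span_def by (rule span_base) auto

lemma mult_in_square: "a \<in> S \<Longrightarrow> b \<in> S \<Longrightarrow> a * b \<in> square"
  unfolding square_def by (rule span_base) auto

lemma mult_in_cube: "a \<in> S \<Longrightarrow> b \<in> S \<Longrightarrow> c \<in> S \<Longrightarrow> a * b * c \<in> cube"
  unfolding triple_product_def by (rule span_base) auto

lemma S_subset_square: "S \<subseteq> square"
  using mult_in_square[OF _ one_in_S] by auto

lemma comm_span_subset_square: "comm_span \<subseteq> square"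
  unfolding comm_span_def
  by (rule span_minimal) (auto intro: subspace_diff subspace_square mult_in_square)

lemma comm_span_subset_K: "comm_span \<subseteq> K"
  unfolding comm_span_def
  by (rule span_minimal) (auto simp: mem_K mem_S star_diff star_mult subspace_K)

lemma square_mult_S:
  assumes "d \<in> square" "s \<in> S"
  shows "d * s \<in> cube"
  using assms(1) unfolding square_def
proof (induction rule: span_induct_alt)
  case base
  show ?case using subspace_0[OF subspace_cube] by simp
next
  case (step c x y)
  then have "x * s \<in> cube" using mult_in_cube assms(2) by blast
  then show ?case
    using step by (auto simp: distrib_right scale_mult_left
        intro: subspace_add subspace_scale subspace_cube)
qed

lemma S_mult_square:
  assumes "s \<in> S" "d \<in> square"
  shows "s * d \<in> cube"
  using assms(2) unfolding square_def
proof (induction rule: span_induct_alt)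
  case base
  show ?case using subspace_0[OF subspace_cube] by simp
next
  case (step c x y)
  then have "s * x \<in> cube" using mult_in_cube assms(1) by (auto simp: mult.assoc)
  then show ?case
    using step by (auto simp: distrib_left scale_mult_right
        intro: subspace_add subspace_scale subspace_cube)
qed

lemma square_subset_cube: "square \<subseteq> cube"
  using square_mult_S[OF _ one_in_S] by auto

lemma commutator_S_K: "s \<in> S \<Longrightarrow> k \<in> K \<Longrightarrow> s * k - k * s \<in> S"
  by (simp add: mem_S mem_K star_diff star_mult)

text \<open>
  \<open>K\<close> is a Lie algebra that acts on \<open>S\<close> by commutators, so by the Jacobi identity it acts on
  \<open>[S, S]\<close> too: \<open>[[a, b], k] = [[a, k], b] + [a, [b, k]]\<close>.
\<close>
lemma commutator_comm_span_K:
  assumes "c \<in> comm_span" "k \<in> K"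
  shows "c * k - k * c \<in> comm_span"
  using assms(1) unfolding comm_span_def
proof (induction rule: span_induct_alt)
  case base
  show ?case by (simp add: span_zero)
next
  case (step r x y)
  then obtain a b where x: "x = a * b - b * a" and ab: "a \<in> S" "b \<in> S" by blast
  let ?a = "a * k - k * a" and ?b = "b * k - k * b"
  have "x * k - k * x = (?a * b - b * ?a) + (a * ?b - ?b * a)"
    by (simp add: x algebra_simps)
  then have "x * k - k * x \<in> comm_span"
    using subspace_comm_span ab assms(2)
    by (simp add: subspace_add commutator_in_comm_span commutator_S_K)
  then have "r *s (x * k - k * x) + (y * k - k * y) \<in> comm_span"
    using step subspace_comm_span
    by (intro subspace_add subspace_scale) (auto simp: comm_span_def)
  moreover have "r *s (x * k - k * x) + (y * k - k * y) = (r *s x + y) * k - k * (r *s x + y)"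
    by (simp add: algebra_simps scale_mult_left scale_mult_right)
  ultimately show ?case by (simp add: comm_span_def)
qed

text \<open>
  The Jordan part \<open>ck + kc\<close> of two skew elements is symmetric, and the Lie part is in \<open>[S, S]\<close>
  again. Both lie in \<open>S\<^sup>2\<close>, hence so does \<open>2ck\<close>.
\<close>
lemma comm_span_mult_K:
  assumes "c \<in> comm_span" "k \<in> K"
  shows "c * k \<in> square"
proof (rule subspace_halve[OF subspace_square])
  have "c * k + k * c \<in> square"
    using assms comm_span_subset_K S_subset_square
    by (auto simp: mem_S mem_K star_add star_mult subset_iff add.commute)
  moreover have "c * k - k * c \<in> square"
    using commutator_comm_span_K[OF assms] comm_span_subset_square by blast
  ultimately have "(c * k + k * c) + (c * k - k * c) \<in> square"
    using subspace_add[OF subspace_square] by blast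
  then show "c * k + c * k \<in> square" by simp
qed

section \<open>The ideal generated by the commutators\<close>

lemma comm_span_mult_in_cube:
  assumes "c \<in> comm_span"
  shows "c * x \<in> cube"
proof (rule symmetric_skew_cases[OF subspace_cube, where f = "\<lambda>x. c * x"])
  show "c * (x + y) = c * x + c * y" for x y by (rule distrib_left)
next
  fix x assume "x \<in> S"
  then show "c * x \<in> cube"
    using assms comm_span_subset_square square_mult_S by blast
next
  fix x assume "x \<in> K"
  then show "c * x \<in> cube"
    using assms comm_span_mult_K square_subset_cube by blast
qed

text \<open>
  Only for symmetric \<open>x\<close> does the shape of \<open>y\<close> matter: \<open>[x, c]\<close> is then merely symmetric, so
  \<open>[x, c] y\<close> is under control for symmetric \<open>y\<close>, while for skew \<open>y\<close> the product \<open>cy\<close> already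
  falls into \<open>S\<^sup>2\<close>.
\<close>
lemma mult_comm_span_mult_in_cube:
  assumes c: "c \<in> comm_span"
  shows "x * c * y \<in> cube"
proof (rule symmetric_skew_cases[OF subspace_cube, where f = "\<lambda>x. x * c * y"])
  show "(x + x') * c * y = x * c * y + x' * c * y" for x x' by (simp add: distrib_right)
next
  fix k assume k: "k \<in> K"
  have "c * (k * y) - (c * k - k * c) * y \<in> cube"
    by (intro subspace_diff subspace_cube comm_span_mult_in_cube commutator_comm_span_K c k)
  then show "k * c * y \<in> cube" by (simp add: algebra_simps)
next
  fix s assume s: "s \<in> S"
  show "s * c * y \<in> cube"
  proof (rule symmetric_skew_cases[OF subspace_cube, where f = "\<lambda>y. s * c * y"])
    show "s * c * (y + y') = s * c * y + s * c * y'" for y y' by (rule distrib_left)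
  next
    fix t assume t: "t \<in> S"
    have "s * c - c * s \<in> S"
      using commutator_S_K s c comm_span_subset_K by blast
    then have "(s * c - c * s) * t \<in> cube"
      using mult_in_square[OF _ t] square_subset_cube by blast
    then have "(s * c - c * s) * t + c * (s * t) \<in> cube"
      by (rule subspace_add[OF subspace_cube _ comm_span_mult_in_cube[OF c]])
    then show "s * c * t \<in> cube" by (simp add: algebra_simps)
  next
    fix k assume "k \<in> K"
    then show "s * c * k \<in> cube"
      using S_mult_square[OF s comm_span_mult_K[OF c]] by (simp add: mult.assoc)
  qed
qed

text \<open>
  Instead of generating an ideal from a commutator, take the largest ideal contained in \<open>S\<^sup>3\<close>: it
  contains every commutator of symmetric elements, and it is all of \<open>R\<close> as soon as it is nonzero.
\<close>
theorem cube_eq_UNIV: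
  assumes simple: "simple_ring TYPE('r)" and noncomm: "\<not> commutative_set S"
  shows "cube = UNIV"
proof -
  define I where "I = {z. \<forall>x y. x * z * y \<in> cube}"
  have "two_sided_ideal I"
    unfolding two_sided_ideal_def
  proof (intro conjI ballI allI)
    show "0 \<in> I"
      by (simp add: I_def subspace_0 subspace_cube)
    show "z + w \<in> I" if "z \<in> I" "w \<in> I" for z w
      using that by (simp add: I_def distrib_left distrib_right subspace_add subspace_cube)
    show "- z \<in> I" if "z \<in> I" for z
      using that by (simp add: I_def subspace_neg subspace_cube)
    show "r * z \<in> I" if "z \<in> I" for z r
      using that by (simp add: I_def flip: mult.assoc)
    show "z * r \<in> I" if "z \<in> I" for z r
      using that by (simp add: I_def mult.assoc)
  qed
  moreover obtain a b where ab: "a \<in> S" "b \<in> S" "a * b \<noteq> b * a"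
    using noncomm by (auto simp: commutative_set_def)
  then have "a * b - b * a \<in> I"
    using commutator_in_comm_span mult_comm_span_mult_in_cube by (simp add: I_def)
  then have "I \<noteq> {0}"
    using ab by auto
  ultimately have "I = UNIV"
    using simple by (auto simp: simple_ring_def)
  then have "x * 1 * 1 \<in> cube" for x
    unfolding I_def by blast
  then show ?thesis by auto
qed

end

theorem corollary2p4:
  fixes scale :: "'f::field \<Rightarrow> 'r::ring_1 \<Rightarrow> 'r"
    and star :: "'r \<Rightarrow> 'r"
    and S :: "'r set"
  assumes "CHAR('f) \<noteq> 2"
    and "unital_algebra scale"
    and "simple_ring TYPE('r)"
    and "ring_involution star"
    and "first_kind star"
    and "S = symmetric_elements star"
    and "S \<subset> UNIV"
    and "\<not> commutative_set S"
  shows "unital_algebra.triple_product scale S S S = UNIV"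
proof -
  have "(2::'f) \<noteq> 0"
  proof
    assume "(2::'f) = 0"
    then have "CHAR('f) dvd 2"
      using of_nat_eq_0_iff_char_dvd[of 2, where 'a='f] by simp
    moreover have "CHAR('f) \<noteq> 1"
      using of_nat_CHAR[where 'a='f] by auto
    ultimately show False
      using assms(1) dvd_imp_le[of "CHAR('f)" 2] by (auto simp: le_Suc_eq numeral_2_eq_2)
  qed
  then interpret first_kind_algebra scale star
    using assms by (simp add: first_kind_algebra_def first_kind_algebra_axioms_def)
  show ?thesis
    using cube_eq_UNIV assms by simp
qed

end
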